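(* Let $\mathcal{R}$ be a finite chain ring with maximal ideal $\langle\gamma\rangle$, nilpotency index $s$ and residue field $\mathcal{R}/\langle\gamma\rangle\cong\mathbb{F}_q$. Let $\mathcal{C}\subseteq\mathcal{R}^n$ be an MHD code. Then its socle $\mathcal{C}_0=\mathcal{C}\cap\langle\gamma^{s-1}\rangle^n$, viewed as a linear code $\overline{\mathcal{C}}\subseteq\mathbb{F}_q^n$, is an MDS code.
   Context: $\mathcal{R}$ is a finite chain ring (not necessarily commutative) with maximal ideal $\langle\gamma\rangle=\gamma\mathcal{R}=\mathcal{R}\gamma$; $s$ is the nilpotency index of $\gamma$ (least positive integer with $\gamma^s=0$); $q$ is the size of the residue field. The socle of $\mathcal{R}$ is $\langle\gamma^{s-1}\rangle$ (with $\gamma^0=1$). A linear code of length $n$ ($n\ge1$) is a left $\mathcal{R}$-submodule $\mathcal{C}\subseteq\mathcal{R}^n$. Its rank $K$ is the minimal number of generators of $\mathcal{C}$. Homogeneous weight: put $M=\frac{q}{q-1}$. For $x\in\mathcal{R}$, $\mathrm{wt}_{\mathrm{Hom}}(x)=0$ if $x=0$, $=M$ if $x\in\langle\gamma^{s-1}\rangle\setminus\{0\}$, and $=1$ if $x\notin\langle\gamma^{s-1}\rangle$. For $x\in\mathcal{R}^n$, $\mathrm{wt}_{\mathrm{Hom}}(x)=\sum_{i=1}^n\mathrm{wt}_{\mathrm{Hom}}(x_i)$. For a linear code $\mathcal{C}\ne\{0\}$, $d_{\mathrm{Hom}}(\mathcal{C})=\min\{\mathrm{wt}_{\mathrm{Hom}}(c):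 c\in\mathcal{C}\setminus\{0\}\}$; by convention $d_{\mathrm{Hom}}(\{0\})=M(n+1)$. A linear code $\mathcal{C}\subseteq\mathcal{R}^n$ of rank $K$ is a Maximum Homogeneous Distance (MHD) code if $d_{\mathrm{Hom}}(\mathcal{C})>M(n-K)$. Socle of a code: $\mathcal{C}_0=\mathcal{C}\cap\langle\gamma^{s-1}\rangle^n$. Via the isomorphism $\mathcal{R}/\langle\gamma\rangle\to\langle\gamma^{s-1}\rangle$, $r+\langle\gamma\rangle\mapsto r\gamma^{s-1}$, applied coordinatewise, $\mathcal{C}_0$ is identified with a linear code $\overline{\mathcal{C}}\subseteq\mathbb{F}_q^n$, which has $\mathbb{F}_q$-dimension $K$. A linear code over $\mathbb{F}_q$ of length $n$ and dimension $k$ is MDS if its minimum Hamming distance equals $n-k+1$, where the zero code is given minimum Hamming distance $n+1$ by convention. *)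

theory Defs
  imports Complex_Main "HOL-Algebra.QuotRing" "HOL-Algebra.Module" "HOL-Library.FuncSet"
begin

section \<open>Finite chain rings\<close>

definition left_ideal :: "'a set \<Rightarrow> ('a, 'b) ring_scheme \<Rightarrow> bool" where
  "left_ideal I R \<longleftrightarrow> additive_subgroup I R \<and>
     (\<forall>r \<in> carrier R. \<forall>x \<in> I. r \<otimes>\<^bsub>R\<^esub> x \<in> I)"

text \<open>
  The ring need not be commutative. For finite rings, the left ideals form a chain
  if and only if the right ideals do, so only the condition on left ideals is imposed.
\<close>

locale finite_chain_ring = ring R for R (structure) +
  assumes finite_carrier: "finite (carrier R)"
    and left_ideal_chain:
      "\<lbrakk>left_ideal I R; left_ideal J R\<rbrakk> \<Longrightarrow> I \<subseteq> J \<or> J \<subseteq> I"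

definition nilpotency_index :: "('a, 'b) ring_scheme \<Rightarrow> 'a \<Rightarrow> nat \<Rightarrow> bool" where
  "nilpotency_index R \<gamma> s \<longleftrightarrow> 0 < s \<and> \<gamma> [^]\<^bsub>R\<^esub> s = \<zero>\<^bsub>R\<^esub> \<and>
     (\<forall>t. 0 < t \<and> t < s \<longrightarrow> \<gamma> [^]\<^bsub>R\<^esub> t \<noteq> \<zero>\<^bsub>R\<^esub>)"

definition ring_socle :: "('a, 'b) ring_scheme \<Rightarrow> 'a \<Rightarrow> nat \<Rightarrow> 'a set" where
  "ring_socle R \<gamma> s = Idl\<^bsub>R\<^esub> {\<gamma> [^]\<^bsub>R\<^esub> (s - 1)}"

abbreviation residue_ring_of :: "('a, 'b) ring_scheme \<Rightarrow> 'a \<Rightarrow> 'a set ring" where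
  "residue_ring_of R \<gamma> \<equiv> R Quot (Idl\<^bsub>R\<^esub> {\<gamma>})"

section \<open>Linear codes\<close>

text \<open>
  The left module of vectors of length \<open>n\<close>: functions on \<open>{..<n}\<close>, extended by \<open>undefined\<close>.
  The library locale \<^locale>\<open>module\<close> assumes a commutative scalar ring, but its record
  and the locale \<^locale>\<open>submodule\<close> do not.
  The coordinatewise product and unit only fill the remaining fields of the record.
\<close>

definition vec_module :: "('a, 'b) ring_scheme \<Rightarrow> nat \<Rightarrow> ('a, nat \<Rightarrow> 'a) module" where
  "vec_module R n = \<lparr>
     carrier = {..<n} \<rightarrow>\<^sub>E carrier R,
     mult = (\<lambda>x y. \<lambda>i\<in>{..<n}. x i \<otimes>\<^bsub>R\<^esub> y i),
     one = (\<lambda>i\<in>{..<n}. \<one>\<^bsub>R\<^esub>),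
     zero = (\<lambda>i\<in>{..<n}. \<zero>\<^bsub>R\<^esub>),
     add = (\<lambda>x y. \<lambda>i\<in>{..<n}. x i \<oplus>\<^bsub>R\<^esub> y i),
     smult = (\<lambda>a x. \<lambda>i\<in>{..<n}. a \<otimes>\<^bsub>R\<^esub> x i)\<rparr>"

definition linear_code :: "('a, 'b) ring_scheme \<Rightarrow> nat \<Rightarrow> (nat \<Rightarrow> 'a) set \<Rightarrow> bool" where
  "linear_code R n C \<longleftrightarrow> submodule C R (vec_module R n)"

definition code_span :: "('a, 'b) ring_scheme \<Rightarrow> nat \<Rightarrow> (nat \<Rightarrow> 'a) set \<Rightarrow> (nat \<Rightarrow> 'a) set" where
  "code_span R n G = \<Inter>{D. linear_code R n D \<and> G \<subseteq> D}"

definition code_rank :: "('a, 'b) ring_scheme \<Rightarrow> nat \<Rightarrow> (nat \<Rightarrow> 'a) set \<Rightarrow> nat" where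
  "code_rank R n C = (LEAST k. \<exists>G. finite G \<and> G \<subseteq> carrier (vec_module R n) \<and>
     card G = k \<and> code_span R n G = C)"

section \<open>Homogeneous weight and MHD codes\<close>

definition hom_const :: "('a, 'b) ring_scheme \<Rightarrow> 'a \<Rightarrow> real" where
  "hom_const R \<gamma> = (let q = real (card (carrier (residue_ring_of R \<gamma>))) in q / (q - 1))"

definition hom_weight :: "('a, 'b) ring_scheme \<Rightarrow> 'a \<Rightarrow> nat \<Rightarrow> 'a \<Rightarrow> real" where
  "hom_weight R \<gamma> s x =
     (if x = \<zero>\<^bsub>R\<^esub> then 0 else if x \<in> ring_socle R \<gamma> s then hom_const R \<gamma> else 1)"

definition hom_weight_vec ::
    "('a, 'b) ring_scheme \<Rightarrow> 'a \<Rightarrow> nat \<Rightarrow> nat \<Rightarrow> (nat \<Rightarrow> 'a) \<Rightarrow> real" where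
  "hom_weight_vec R \<gamma> s n x = (\<Sum>i<n. hom_weight R \<gamma> s (x i))"

definition hom_dist ::
    "('a, 'b) ring_scheme \<Rightarrow> 'a \<Rightarrow> nat \<Rightarrow> nat \<Rightarrow> (nat \<Rightarrow> 'a) set \<Rightarrow> real" where
  "hom_dist R \<gamma> s n C =
     (if C = {\<zero>\<^bsub>vec_module R n\<^esub>} then hom_const R \<gamma> * (real n + 1)
      else Min (hom_weight_vec R \<gamma> s n ` (C - {\<zero>\<^bsub>vec_module R n\<^esub>})))"

definition MHD_code ::
    "('a, 'b) ring_scheme \<Rightarrow> 'a \<Rightarrow> nat \<Rightarrow> nat \<Rightarrow> (nat \<Rightarrow> 'a) set \<Rightarrow> bool" where
  "MHD_code R \<gamma> s n C \<longleftrightarrow> linear_code R n C \<and>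
     hom_dist R \<gamma> s n C > hom_const R \<gamma> * (real n - real (code_rank R n C))"

section \<open>The socle of a code\<close>

definition code_socle ::
    "('a, 'b) ring_scheme \<Rightarrow> 'a \<Rightarrow> nat \<Rightarrow> nat \<Rightarrow> (nat \<Rightarrow> 'a) set \<Rightarrow> (nat \<Rightarrow> 'a) set" where
  "code_socle R \<gamma> s n C = C \<inter> ({..<n} \<rightarrow>\<^sub>E ring_socle R \<gamma> s)"

text \<open>
  Given an isomorphism \<open>h\<close> from the residue ring onto \<open>F\<close>, the following is the set of all
  vectors over \<open>F\<close> that correspond to a word of the socle of \<open>C\<close>, where the coset of \<open>r\<close> in
  the residue ring corresponds to \<open>r \<otimes> \<gamma> [^] (s - 1)\<close> in the socle of the ring.
\<close>

definition socle_code ::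
    "('a, 'b) ring_scheme \<Rightarrow> 'a \<Rightarrow> nat \<Rightarrow> ('a set \<Rightarrow> 'c) \<Rightarrow> nat \<Rightarrow> (nat \<Rightarrow> 'a) set
      \<Rightarrow> (nat \<Rightarrow> 'c) set" where
  "socle_code R \<gamma> s h n C =
     {\<lambda>i\<in>{..<n}. h (Idl\<^bsub>R\<^esub> {\<gamma>} +>\<^bsub>R\<^esub> r i) | r. r \<in> {..<n} \<rightarrow>\<^sub>E carrier R \<and>
        (\<lambda>i\<in>{..<n}. r i \<otimes>\<^bsub>R\<^esub> \<gamma> [^]\<^bsub>R\<^esub> (s - 1)) \<in> code_socle R \<gamma> s n C}"

section \<open>MDS codes over a field\<close>

definition hamming_weight :: "('a, 'b) ring_scheme \<Rightarrow> nat \<Rightarrow> (nat \<Rightarrow> 'a) \<Rightarrow> nat" where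
  "hamming_weight F n x = card {i. i < n \<and> x i \<noteq> \<zero>\<^bsub>F\<^esub>}"

definition hamming_dist :: "('a, 'b) ring_scheme \<Rightarrow> nat \<Rightarrow> (nat \<Rightarrow> 'a) set \<Rightarrow> nat" where
  "hamming_dist F n D =
     (if D = {\<zero>\<^bsub>vec_module F n\<^esub>} then n + 1
      else Min (hamming_weight F n ` (D - {\<zero>\<^bsub>vec_module F n\<^esub>})))"

definition code_basis ::
    "('a, 'b) ring_scheme \<Rightarrow> nat \<Rightarrow> (nat \<Rightarrow> 'a) set \<Rightarrow> (nat \<Rightarrow> 'a) set \<Rightarrow> bool" where
  "code_basis F n D B \<longleftrightarrow> finite B \<and> B \<subseteq> carrier (vec_module F n) \<and> code_span F n B = D \<and>
     (\<forall>a \<in> B \<rightarrow> carrier F.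
        (\<Oplus>\<^bsub>vec_module F n\<^esub> b \<in> B. a b \<odot>\<^bsub>vec_module F n\<^esub> b) = \<zero>\<^bsub>vec_module F n\<^esub>
          \<longrightarrow> (\<forall>b \<in> B. a b = \<zero>\<^bsub>F\<^esub>))"

definition code_dimension ::
    "('a, 'b) ring_scheme \<Rightarrow> nat \<Rightarrow> (nat \<Rightarrow> 'a) set \<Rightarrow> nat \<Rightarrow> bool" where
  "code_dimension F n D k \<longleftrightarrow> (\<exists>B. code_basis F n D B \<and> card B = k)"

definition MDS_code :: "('a, 'b) ring_scheme \<Rightarrow> nat \<Rightarrow> (nat \<Rightarrow> 'a) set \<Rightarrow> bool" where
  "MDS_code F n D \<longleftrightarrow> linear_code F n D \<and>
     (\<exists>k. code_dimension F n D k \<and> int (hamming_dist F n D) = int n - int k + 1)"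

end

theory Submission
  imports Defs "HOL-Algebra.Multiplicative_Group"
begin

text \<open>
  A nonzero word \<open>v\<close> of the socle code corresponds to a nonzero word of \<open>C\<close> with
  homogeneous weight \<open>M\<close> times the Hamming weight of \<open>v\<close>, so the MHD property gives
  minimum Hamming distance at least \<open>n - K + 1\<close>. By the Singleton bound it is at most
  \<open>n - k + 1\<close>, where \<open>k\<close> is the dimension of the socle code, so it suffices to show
  \<open>K \<le> k\<close>. Multiplication by \<open>\<gamma>\<close> is additive on \<open>C\<close> and its kernel is the socle, so
  \<open>|C| = |\<gamma>C| q\<^sup>k\<close>. In a relation between \<open>K\<close> minimal generators of \<open>C\<close> no coefficient
  is a unit; hence the combinations of the generators with coefficients taken from a
  transversal of \<open>R/\<langle>\<gamma>\<rangle>\<close> lie in distinct cosets of \<open>\<gamma>C\<close>, and \<open>q\<^sup>K |\<gamma>C| \<le> |C|\<close>.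
\<close>

section \<open>Left modules\<close>

text \<open>The axioms of a left module over a ring that may be noncommutative;
  \<open>smult_assoc\<close> fixes the order in which scalars act.\<close>

locale left_module = R?: ring R + M?: abelian_group M
  for R :: "('a, 'b) ring_scheme" (structure) and M :: "('a, 'c, 'd) module_scheme" (structure) +
  assumes smult_closed [simp, intro]:
      "\<lbrakk>a \<in> carrier R; x \<in> carrier M\<rbrakk> \<Longrightarrow> a \<odot>\<^bsub>M\<^esub> x \<in> carrier M"
    and smult_l_distr:
      "\<lbrakk>a \<in> carrier R; b \<in> carrier R; x \<in> carrier M\<rbrakk> \<Longrightarrow>
        (a \<oplus> b) \<odot>\<^bsub>M\<^esub> x = a \<odot>\<^bsub>M\<^esub> x \<oplus>\<^bsub>M\<^esub> b \<odot>\<^bsub>M\<^esub> x"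
    and smult_r_distr:
      "\<lbrakk>a \<in> carrier R; x \<in> carrier M; y \<in> carrier M\<rbrakk> \<Longrightarrow>
        a \<odot>\<^bsub>M\<^esub> (x \<oplus>\<^bsub>M\<^esub> y) = a \<odot>\<^bsub>M\<^esub> x \<oplus>\<^bsub>M\<^esub> a \<odot>\<^bsub>M\<^esub> y"
    and smult_assoc:
      "\<lbrakk>a \<in> carrier R; b \<in> carrier R; x \<in> carrier M\<rbrakk> \<Longrightarrow>
        (a \<otimes> b) \<odot>\<^bsub>M\<^esub> x = a \<odot>\<^bsub>M\<^esub> (b \<odot>\<^bsub>M\<^esub> x)"
    and smult_one [simp]:
      "x \<in> carrier M \<Longrightarrow> \<one> \<odot>\<^bsub>M\<^esub> x = x"
begin

lemma smult_l_null [simp]: "x \<in> carrier M \<Longrightarrow> \<zero> \<odot>\<^bsub>M\<^esub> x = \<zero>\<^bsub>M\<^esub>"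
  by (metis M.add.r_cancel_one' R.r_zero R.zero_closed smult_closed smult_l_distr)

lemma smult_r_null [simp]: "a \<in> carrier R \<Longrightarrow> a \<odot>\<^bsub>M\<^esub> \<zero>\<^bsub>M\<^esub> = \<zero>\<^bsub>M\<^esub>"
  by (metis M.add.r_cancel_one' M.r_zero M.zero_closed smult_closed smult_r_distr)

lemma smult_l_minus:
  assumes "a \<in> carrier R" "x \<in> carrier M"
  shows "(\<ominus> a) \<odot>\<^bsub>M\<^esub> x = \<ominus>\<^bsub>M\<^esub> (a \<odot>\<^bsub>M\<^esub> x)"
proof -
  have "(\<ominus> a) \<odot>\<^bsub>M\<^esub> x \<oplus>\<^bsub>M\<^esub> a \<odot>\<^bsub>M\<^esub> x = \<zero>\<^bsub>M\<^esub>"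
    using assms smult_l_distr[of "\<ominus> a" a x] by (simp add: R.l_neg)
  then show ?thesis using assms by (simp add: M.minus_equality)
qed

lemma smult_r_minus:
  assumes "a \<in> carrier R" "x \<in> carrier M" "y \<in> carrier M"
  shows "a \<odot>\<^bsub>M\<^esub> (x \<ominus>\<^bsub>M\<^esub> y) = a \<odot>\<^bsub>M\<^esub> x \<ominus>\<^bsub>M\<^esub> a \<odot>\<^bsub>M\<^esub> y"
proof -
  have "a \<odot>\<^bsub>M\<^esub> (\<ominus>\<^bsub>M\<^esub> y) \<oplus>\<^bsub>M\<^esub> a \<odot>\<^bsub>M\<^esub> y = \<zero>\<^bsub>M\<^esub>"
    using assms smult_r_distr[of a "\<ominus>\<^bsub>M\<^esub> y" y] by (simp add: M.l_neg)
  then have "a \<odot>\<^bsub>M\<^esub> (\<ominus>\<^bsub>M\<^esub> y) = \<ominus>\<^bsub>M\<^esub> (a \<odot>\<^bsub>M\<^esub> y)" using assms by (simp add: M.minus_equality)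
  then show ?thesis using assms by (simp add: M.minus_eq smult_r_distr)
qed

lemma smult_finsum:
  assumes "a \<in> carrier R" "f \<in> A \<rightarrow> carrier M"
  shows "a \<odot>\<^bsub>M\<^esub> (\<Oplus>\<^bsub>M\<^esub>i\<in>A. f i) = (\<Oplus>\<^bsub>M\<^esub>i\<in>A. a \<odot>\<^bsub>M\<^esub> f i)"
  using assms(2)
proof (induction A rule: infinite_finite_induct)
  case (insert x F)
  then show ?case using assms(1) 
    by (simp add: Pi_iff smult_r_distr M.finsum_closed)
qed (use assms(1) in auto)

text \<open>Negation is scalar multiplication by \<open>\<ominus> \<one>\<close>, so the subgroup
  axioms reduce to closure under zero, sums and scalars.\<close>

lemma submodule_iff:
  "submodule N R M \<longleftrightarrow> N \<subseteq> carrier M \<and> \<zero>\<^bsub>M\<^esub> \<in> N \<and>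
     (\<forall>x\<in>N. \<forall>y\<in>N. x \<oplus>\<^bsub>M\<^esub> y \<in> N) \<and> (\<forall>a\<in>carrier R. \<forall>x\<in>N. a \<odot>\<^bsub>M\<^esub> x \<in> N)"
  (is "?l \<longleftrightarrow> ?r")
proof
  assume ?l
  then interpret submodule N R M .
  show ?r using subset one_closed m_closed smult_closed by auto
next
  assume r: ?r
  have "\<ominus>\<^bsub>M\<^esub> x \<in> N" if "x \<in> N" for x
    using that r smult_l_minus[of \<one> x] by (metis R.a_inv_closed R.one_closed smult_one subsetD)
  then show ?l using r
    by (intro submodule.intro subgroup.intro submodule_axioms.intro) (auto simp: a_inv_def)
qed

lemma submodule_minus:
  assumes "submodule N R M" "x \<in> N" "y \<in> N"
  shows "x \<ominus>\<^bsub>M\<^esub> y \<in> N"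
proof -
  interpret N: submodule N R M by fact
  show ?thesis using assms N.m_closed N.m_inv_closed by (simp add: M.minus_eq a_inv_def)
qed

lemma submodule_finsum:
  assumes "submodule N R M" "f \<in> A \<rightarrow> N"
  shows "(\<Oplus>\<^bsub>M\<^esub>i\<in>A. f i) \<in> N"
  using assms(2)
proof (induction A rule: infinite_finite_induct)
  case (insert x F)
  then have "f \<in> F \<rightarrow> carrier M" "f x \<in> carrier M"
    using assms(1) unfolding submodule_iff by auto
  then show ?case using insert assms(1) by (simp add: submodule_iff)
qed (use assms(1) in \<open>auto simp: submodule_iff\<close>)

text \<open>The linear combinations of \<open>G\<close> form a submodule containing
  \<open>G\<close>, and every submodule containing \<open>G\<close> contains them. Coefficients are
  extensional functions so that they can be counted later.\<close>

lemma Inter_submodules_eq: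
  assumes "finite G" "G \<subseteq> carrier M"
  shows "\<Inter>{N. submodule N R M \<and> G \<subseteq> N} =
    (\<lambda>a. \<Oplus>\<^bsub>M\<^esub>g\<in>G. a g \<odot>\<^bsub>M\<^esub> g) ` (G \<rightarrow>\<^sub>E carrier R)" (is "_ = ?S")
proof (rule antisym)
  \<comment> \<open>Only the values on \<open>G\<close> enter the sum, so coefficient functions may
    be given without regard to extensionality.\<close>
  have S: "(\<Oplus>\<^bsub>M\<^esub>g\<in>G. a g \<odot>\<^bsub>M\<^esub> g) \<in> ?S" if "a \<in> G \<rightarrow> carrier R" for a
  proof (rule image_eqI)
    show "restrict a G \<in> G \<rightarrow>\<^sub>E carrier R" using that by auto
    show "(\<Oplus>\<^bsub>M\<^esub>g\<in>G. a g \<odot>\<^bsub>M\<^esub> g) = (\<Oplus>\<^bsub>M\<^esub>g\<in>G. restrict a G g \<odot>\<^bsub>M\<^esub> g)"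
      using that assms(2) by (intro M.finsum_cong') (auto intro!: smult_closed)
  qed
  have cl: "(\<lambda>g. a g \<odot>\<^bsub>M\<^esub> g) \<in> G \<rightarrow> carrier M" if "a \<in> G \<rightarrow> carrier R" for a
    using that assms(2) by (auto intro!: smult_closed)
  have "submodule ?S R M"
    unfolding submodule_iff
  proof (intro conjI ballI)
    show "?S \<subseteq> carrier M" using cl by (auto intro!: M.finsum_closed)
    have "(\<Oplus>\<^bsub>M\<^esub>g\<in>G. \<zero> \<odot>\<^bsub>M\<^esub> g) = \<zero>\<^bsub>M\<^esub>"
      using assms(2) by (intro M.add.finprod_one_eqI) auto
    then show "\<zero>\<^bsub>M\<^esub> \<in> ?S" using S[of "\<lambda>_. \<zero>"] by simp
  next
    fix x y assume "x \<in> ?S" "y \<in> ?S"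
    then obtain a b where ab: "a \<in> G \<rightarrow>\<^sub>E carrier R" "b \<in> G \<rightarrow>\<^sub>E carrier R"
      "x = (\<Oplus>\<^bsub>M\<^esub>g\<in>G. a g \<odot>\<^bsub>M\<^esub> g)" "y = (\<Oplus>\<^bsub>M\<^esub>g\<in>G. b g \<odot>\<^bsub>M\<^esub> g)" by auto
    have "x \<oplus>\<^bsub>M\<^esub> y = (\<Oplus>\<^bsub>M\<^esub>g\<in>G. a g \<odot>\<^bsub>M\<^esub> g \<oplus>\<^bsub>M\<^esub> b g \<odot>\<^bsub>M\<^esub> g)"
      using ab cl[of a] cl[of b] by (simp add: M.finsum_addf PiE_iff Pi_iff)
    also have "\<dots> = (\<Oplus>\<^bsub>M\<^esub>g\<in>G. (a g \<oplus> b g) \<odot>\<^bsub>M\<^esub> g)"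
      using ab assms(2) by (intro M.finsum_cong') (auto simp: smult_l_distr PiE_iff subset_iff)
    finally show "x \<oplus>\<^bsub>M\<^esub> y \<in> ?S" using S[of "\<lambda>g. a g \<oplus> b g"] ab by (simp add: PiE_iff Pi_iff)
  next
    fix r x assume r: "r \<in> carrier R" and "x \<in> ?S"
    then obtain a where a: "a \<in> G \<rightarrow>\<^sub>E carrier R" "x = (\<Oplus>\<^bsub>M\<^esub>g\<in>G. a g \<odot>\<^bsub>M\<^esub> g)" by auto
    have "r \<odot>\<^bsub>M\<^esub> x = (\<Oplus>\<^bsub>M\<^esub>g\<in>G. r \<odot>\<^bsub>M\<^esub> (a g \<odot>\<^bsub>M\<^esub> g))"
      using a r cl[of a] by (simp add: smult_finsum PiE_iff Pi_iff)
    also have "\<dots> = (\<Oplus>\<^bsub>M\<^esub>g\<in>G. (r \<otimes> a g) \<odot>\<^bsub>M\<^esub> g)"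
      using a r assms(2) by (intro M.finsum_cong') (auto simp: smult_assoc PiE_iff subset_iff)
    finally show "r \<odot>\<^bsub>M\<^esub> x \<in> ?S" using S[of "\<lambda>g. r \<otimes> a g"] a r by (simp add: PiE_iff Pi_iff)
  qed
  moreover have "G \<subseteq> ?S"
  proof
    fix x assume x: "x \<in> G"
    have "(\<Oplus>\<^bsub>M\<^esub>g\<in>G. (if g = x then \<one> else \<zero>) \<odot>\<^bsub>M\<^esub> g) = (\<Oplus>\<^bsub>M\<^esub>g\<in>G. if x = g then g else \<zero>\<^bsub>M\<^esub>)"
      using assms(2) by (intro M.finsum_cong') (auto simp: subset_iff)
    also have "\<dots> = x"
      using M.add.finprod_singleton[OF x assms(1), of "\<lambda>g. g"] assms(2) by auto
    finally show "x \<in> ?S" using S[of "\<lambda>g. if g = x then \<one> else \<zero>"] by simp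
  qed
  ultimately show "\<Inter>{N. submodule N R M \<and> G \<subseteq> N} \<subseteq> ?S" by auto
next
  show "?S \<subseteq> \<Inter>{N. submodule N R M \<and> G \<subseteq> N}"
    by (auto intro!: submodule_finsum simp: submodule_iff subset_iff PiE_iff)
qed

text \<open>The relation can be solved for \<open>u\<close>: multiplying by \<open>inv (a u)\<close>
  on the left expresses \<open>u\<close> through the remaining generators.\<close>

lemma Inter_submodules_Diff_unit:
  assumes "finite G" "G \<subseteq> carrier M" and a: "a \<in> G \<rightarrow> carrier R"
    and rel: "(\<Oplus>\<^bsub>M\<^esub>g\<in>G. a g \<odot>\<^bsub>M\<^esub> g) = \<zero>\<^bsub>M\<^esub>" and u: "u \<in> G" "a u \<in> Units R"
  shows "\<Inter>{N. submodule N R M \<and> G - {u} \<subseteq> N} = \<Inter>{N. submodule N R M \<and> G \<subseteq> N}"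
proof -
  have "u \<in> N" if N: "submodule N R M" "G - {u} \<subseteq> N" for N
  proof -
    let ?y = "\<Oplus>\<^bsub>M\<^esub>g\<in>G - {u}. a g \<odot>\<^bsub>M\<^esub> g"
    have [simp]: "u \<in> carrier M" "a u \<in> carrier R" using u assms(2) a by auto
    have y: "?y \<in> N"
    proof (rule submodule_finsum[OF N(1)])
      show "(\<lambda>g. a g \<odot>\<^bsub>M\<^esub> g) \<in> G - {u} \<rightarrow> N"
        using N a by (auto simp: submodule_iff dest!: subsetD)
    qed
    then have [simp]: "?y \<in> carrier M" using N(1) by (auto simp: submodule_iff)
    have "(\<Oplus>\<^bsub>M\<^esub>g\<in>insert u (G - {u}). a g \<odot>\<^bsub>M\<^esub> g) = a u \<odot>\<^bsub>M\<^esub> u \<oplus>\<^bsub>M\<^esub> ?y"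
      using assms(1,2) a by (intro M.finsum_insert) (auto simp: subset_iff Pi_iff)
    then have "a u \<odot>\<^bsub>M\<^esub> u \<oplus>\<^bsub>M\<^esub> ?y = \<zero>\<^bsub>M\<^esub>"
      using rel u(1) by (simp add: insert_absorb)
    then have "a u \<odot>\<^bsub>M\<^esub> u = \<ominus>\<^bsub>M\<^esub> ?y" by (simp add: M.minus_equality)
    also have "\<dots> = (\<ominus> \<one>) \<odot>\<^bsub>M\<^esub> ?y" by (simp add: smult_l_minus)
    finally have "inv (a u) \<odot>\<^bsub>M\<^esub> (a u \<odot>\<^bsub>M\<^esub> u) \<in> N"
      using y N(1) u(2) by (simp add: submodule_iff)
    then show "u \<in> N" using u(2) by (simp flip: smult_assoc)
  qed
  then show ?thesis by (intro arg_cong[where f = Inter]) blast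
qed

text \<open>Turns a coincidence of two combinations into a relation, the form to which minimality of
  a generating set applies.\<close>

lemma finsum_smult_eqD:
  assumes "G \<subseteq> carrier M" "a \<in> G \<rightarrow> carrier R" "b \<in> G \<rightarrow> carrier R"
    and eq: "(\<Oplus>\<^bsub>M\<^esub>g\<in>G. a g \<odot>\<^bsub>M\<^esub> g) = (\<Oplus>\<^bsub>M\<^esub>g\<in>G. b g \<odot>\<^bsub>M\<^esub> g)"
  shows "(\<Oplus>\<^bsub>M\<^esub>g\<in>G. (a g \<ominus> b g) \<odot>\<^bsub>M\<^esub> g) = \<zero>\<^bsub>M\<^esub>"
proof -
  have cl: "(\<lambda>g. c g \<odot>\<^bsub>M\<^esub> g) \<in> G \<rightarrow> carrier M" if "c \<in> G \<rightarrow> carrier R" for c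
    using that assms(1) by (auto intro!: smult_closed)
  have d: "(\<lambda>g. a g \<ominus> b g) \<in> G \<rightarrow> carrier R" using assms(2,3) by auto
  have "(\<Oplus>\<^bsub>M\<^esub>g\<in>G. (a g \<ominus> b g) \<odot>\<^bsub>M\<^esub> g) \<oplus>\<^bsub>M\<^esub> (\<Oplus>\<^bsub>M\<^esub>g\<in>G. b g \<odot>\<^bsub>M\<^esub> g) =
      (\<Oplus>\<^bsub>M\<^esub>g\<in>G. (a g \<ominus> b g) \<odot>\<^bsub>M\<^esub> g \<oplus>\<^bsub>M\<^esub> b g \<odot>\<^bsub>M\<^esub> g)"
    by (rule M.finsum_addf[symmetric]) (use cl[OF d] cl[OF assms(3)] in auto)
  also have "\<dots> = (\<Oplus>\<^bsub>M\<^esub>g\<in>G. a g \<odot>\<^bsub>M\<^esub> g)"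
  proof (rule M.finsum_cong')
    fix g assume "g \<in> G"
    then have [simp]: "a g \<in> carrier R" "b g \<in> carrier R" "g \<in> carrier M" using assms(1-3) by auto
    have "a g \<ominus> b g \<oplus> b g = a g" by (simp add: R.minus_eq R.a_assoc R.l_neg)
    then show "(a g \<ominus> b g) \<odot>\<^bsub>M\<^esub> g \<oplus>\<^bsub>M\<^esub> b g \<odot>\<^bsub>M\<^esub> g = a g \<odot>\<^bsub>M\<^esub> g"
      by (simp flip: smult_l_distr)
  qed (use cl[OF assms(2)] in auto)
  finally show ?thesis
    using eq M.finsum_closed[OF cl[OF d]] M.finsum_closed[OF cl[OF assms(3)]]
    by simp
qed

end

lemma (in ring) left_module_vec_module: "left_module R (vec_module R n)"
proof -
  have "abelian_group (vec_module R n)"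
  proof (rule abelian_groupI)
    fix x assume "x \<in> carrier (vec_module R n)"
    then show "\<exists>y\<in>carrier (vec_module R n). y \<oplus>\<^bsub>vec_module R n\<^esub> x = \<zero>\<^bsub>vec_module R n\<^esub>"
      by (intro bexI[of _ "\<lambda>i\<in>{..<n}. \<ominus> x i"])
        (auto simp: vec_module_def PiE_iff l_neg intro!: restrict_ext)
  qed (auto simp: vec_module_def PiE_iff extensional_def a_ac fun_eq_iff)
  then show ?thesis
    by (intro left_module.intro ring_axioms left_module_axioms.intro)
       (auto simp: vec_module_def PiE_iff extensional_def fun_eq_iff l_distr r_distr m_assoc)
qed

section \<open>Generators of linear codes and the Singleton bound\<close>

lemma (in ring) code_span_eq:
  assumes "finite G" "G \<subseteq> carrier (vec_module R n)"
  shows "code_span R n G = (\<lambda>a. \<Oplus>\<^bsub>vec_module R n\<^esub>g\<in>G. a g \<odot>\<^bsub>vec_module R n\<^esub> g) ` (G \<rightarrow>\<^sub>E carrier R)"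
  unfolding code_span_def linear_code_def
  using assms by (rule left_module.Inter_submodules_eq[OF left_module_vec_module])

lemma (in ring) finite_vec_module: "finite (carrier R) \<Longrightarrow> finite (carrier (vec_module R n))"
  by (simp add: vec_module_def finite_PiE)

text \<open>A generator with a unit coefficient in some relation could be dropped, against the
  minimality of \<open>code_rank\<close>.\<close>

lemma (in ring) ex_minimal_generators:
  assumes fin: "finite (carrier R)" and C: "linear_code R n C"
  obtains G where "finite G" "G \<subseteq> carrier (vec_module R n)" "card G = code_rank R n C"
    "code_span R n G = C"
    "\<And>a g. \<lbrakk>a \<in> G \<rightarrow> carrier R;
       (\<Oplus>\<^bsub>vec_module R n\<^esub>g\<in>G. a g \<odot>\<^bsub>vec_module R n\<^esub> g) = \<zero>\<^bsub>vec_module R n\<^esub>; g \<in> G\<rbrakk>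
       \<Longrightarrow> a g \<notin> Units R"
proof -
  let ?V = "vec_module R n"
  interpret V: left_module R ?V by (rule left_module_vec_module)
  let ?P = "\<lambda>k. \<exists>G. finite G \<and> G \<subseteq> carrier ?V \<and> card G = k \<and> code_span R n G = C"
  have "C \<subseteq> carrier ?V" using C by (simp add: linear_code_def V.submodule_iff)
  moreover from this have "finite C" using finite_vec_module[OF fin] by (rule finite_subset)
  \<comment> \<open>The finite code generates itself, so the \<open>LEAST\<close> in
    \<open>code_rank\<close> is attained.\<close>
  moreover have "code_span R n C = C" using C by (auto simp: code_span_def)
  ultimately have "?P (card C)" by blast
  then have "?P (code_rank R n C)" unfolding code_rank_def by (rule LeastI)
  then obtain G where G: "finite G" "G \<subseteq> carrier ?V" "card G = code_rank R n C"
    "code_span R n G = C" by blast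
  have "a g \<notin> Units R" if "a \<in> G \<rightarrow> carrier R"
    "(\<Oplus>\<^bsub>?V\<^esub>g\<in>G. a g \<odot>\<^bsub>?V\<^esub> g) = \<zero>\<^bsub>?V\<^esub>" "g \<in> G" for a g
  proof
    assume "a g \<in> Units R"
    then have "code_span R n (G - {g}) = C"
      using V.Inter_submodules_Diff_unit[OF G(1,2) that] G(4)
      by (simp add: code_span_def linear_code_def)
    then have "?P (card (G - {g}))" using G by blast
    then have "code_rank R n C \<le> card (G - {g})" unfolding code_rank_def by (rule Least_le)
    then show False using G(1,3) \<open>g \<in> G\<close> by (metis card_Diff1_less not_le)
  qed
  then show thesis using that G by blast
qed

text \<open>Over a field every nonzero element is a unit, so a minimal generating set is linearly
  independent, and each codeword has exactly one coefficient function.\<close>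

lemma (in field) code_dimension_card:
  assumes fin: "finite (carrier R)" and D: "linear_code R n D"
  obtains k where "code_dimension R n D k" "card D = card (carrier R) ^ k"
proof -
  let ?V = "vec_module R n"
  interpret V: left_module R ?V by (rule left_module_vec_module)
  obtain G where G: "finite G" "G \<subseteq> carrier ?V" "card G = code_rank R n D" "code_span R n G = D"
    and min: "\<And>a g. \<lbrakk>a \<in> G \<rightarrow> carrier R; (\<Oplus>\<^bsub>?V\<^esub>g\<in>G. a g \<odot>\<^bsub>?V\<^esub> g) = \<zero>\<^bsub>?V\<^esub>; g \<in> G\<rbrakk>
       \<Longrightarrow> a g \<notin> Units R"
    by (rule ex_minimal_generators[OF fin D]) (rule that)
  have indep: "a g = \<zero>" if "a \<in> G \<rightarrow> carrier R"
    "(\<Oplus>\<^bsub>?V\<^esub>g\<in>G. a g \<odot>\<^bsub>?V\<^esub> g) = \<zero>\<^bsub>?V\<^esub>" "g \<in> G" for a g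
    using min[OF that] that(1,3) by (auto simp: field_Units)
  have "inj_on (\<lambda>a. \<Oplus>\<^bsub>?V\<^esub>g\<in>G. a g \<odot>\<^bsub>?V\<^esub> g) (G \<rightarrow>\<^sub>E carrier R)"
  proof (rule inj_onI)
    fix a b assume a: "a \<in> G \<rightarrow>\<^sub>E carrier R" and b: "b \<in> G \<rightarrow>\<^sub>E carrier R"
      and eq: "(\<Oplus>\<^bsub>?V\<^esub>g\<in>G. a g \<odot>\<^bsub>?V\<^esub> g) = (\<Oplus>\<^bsub>?V\<^esub>g\<in>G. b g \<odot>\<^bsub>?V\<^esub> g)"
    have ab: "a \<in> G \<rightarrow> carrier R" "b \<in> G \<rightarrow> carrier R" using a b by auto
    have "a g = b g" if "g \<in> G" for g
      using indep[OF _ V.finsum_smult_eqD[OF G(2) ab eq] that] ab that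
      by (simp add: Pi_iff)
    then show "a = b" using a b by (intro PiE_ext)
  qed
  then have "card D = card (carrier R) ^ card G"
    using code_span_eq[OF G(1,2)] G(1) by (simp add: G(4) card_image card_PiE)
  moreover have "code_dimension R n D (card G)"
    unfolding code_dimension_def code_basis_def using G indep by (intro exI[of _ G]) simp
  ultimately show thesis using that by blast
qed

text \<open>Puncturing: two words that agree on the first \<open>n + 1 - d\<close> coordinates
  differ in fewer than \<open>d\<close> positions and are therefore equal. The assumption
  \<open>0 < d\<close> keeps these coordinates within \<open>{..<n}\<close>.\<close>

lemma (in ring) singleton_bound_card:
  assumes fin: "finite (carrier R)" and D: "linear_code R n D" and "0 < d"
    and wt: "\<And>x. \<lbrakk>x \<in> D; x \<noteq> \<zero>\<^bsub>vec_module R n\<^esub>\<rbrakk> \<Longrightarrow> d \<le> hamming_weight R n x"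
  shows "card D \<le> card (carrier R) ^ (n + 1 - d)"
proof -
  let ?V = "vec_module R n"
  interpret V: left_module R ?V by (rule left_module_vec_module)
  let ?m = "n + 1 - d"
  have DV: "D \<subseteq> {..<n} \<rightarrow>\<^sub>E carrier R"
    using D V.submodule_iff[of D] by (simp add: linear_code_def) (simp add: vec_module_def)
  have "inj_on (\<lambda>x. restrict x {..<?m}) D"
  proof (rule inj_onI)
    fix x y assume xy: "x \<in> D" "y \<in> D" and eq: "restrict x {..<?m} = restrict y {..<?m}"
    \<comment> \<open>The difference of \<open>x\<close> and \<open>y\<close>, written with the
      scalar \<open>\<ominus> \<one>\<close> so that \<open>submodule_iff\<close> puts it in
      \<open>D\<close>.\<close>
    define z where "z = x \<oplus>\<^bsub>?V\<^esub> (\<ominus> \<one>) \<odot>\<^bsub>?V\<^esub> y"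
    have cl: "x i \<in> carrier R" "y i \<in> carrier R" if "i < n" for i
      using DV xy that by auto
    have z: "z i = x i \<ominus> y i" if "i < n" for i
      using that cl[OF that] by (simp add: z_def vec_module_def l_minus minus_eq)
    have "z \<in> D" using xy D by (simp add: z_def linear_code_def V.submodule_iff)
    moreover have "hamming_weight R n z < d"
    proof -
      have "z i = \<zero>" if "i < n" "i < ?m" for i
        using z[OF that(1)] cl[OF that(1)] fun_cong[OF eq, of i] that by simp
      then have "{i. i < n \<and> z i \<noteq> \<zero>} \<subseteq> {?m..<n}" by force
      then have "hamming_weight R n z \<le> n - ?m"
        unfolding hamming_weight_def using card_mono[of "{?m..<n}"] by fastforce
      then show ?thesis using \<open>0 < d\<close> by linarith
    qed
    ultimately have z0: "z = \<zero>\<^bsub>?V\<^esub>" using wt[of z] by linarith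
    have "x i = y i" if "i < n" for i
      using z[OF that] cl[OF that] r_right_minus_eq[of "x i" "y i"] z0 that
      by (simp add: vec_module_def)
    then show "x = y" using DV xy by (intro PiE_ext[of x "{..<n}"]) auto
  qed
  then have "card D \<le> card ({..<?m} \<rightarrow>\<^sub>E carrier R)"
  proof (rule card_inj_on_le)
    have "x i \<in> carrier R" if "x \<in> D" "i < ?m" for x i
      using DV that \<open>0 < d\<close> PiE_mem[of x "{..<n}" "\<lambda>_. carrier R" i] by (auto dest: subsetD)
    then show "(\<lambda>x. restrict x {..<?m}) ` D \<subseteq> {..<?m} \<rightarrow>\<^sub>E carrier R"
      by (intro image_subsetI) (simp add: restrict_PiE_iff)
  qed (simp add: fin finite_PiE)
  then show ?thesis by (simp add: card_PiE)
qed

section \<open>Chain rings\<close>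

locale chain_ring_residue_field = finite_chain_ring R for R :: "('a, 'b) ring_scheme" (structure) +
  fixes F :: "('c, 'd) ring_scheme" and \<gamma> :: 'a and s :: nat and h :: "'a set \<Rightarrow> 'c"
  assumes field_F: "field F"
    and gamma_closed [simp]: "\<gamma> \<in> carrier R"
    and ideal_left: "Idl {\<gamma>} = \<gamma> <# carrier R"
    and ideal_right: "Idl {\<gamma>} = carrier R #> \<gamma>"
    and nilp: "nilpotency_index R \<gamma> s"
    and h_iso: "h \<in> ring_iso (R Quot (Idl {\<gamma>})) F"
begin

section \<open>The residue map onto \<open>F\<close>\<close>

abbreviation residue :: "'a \<Rightarrow> 'c" where "residue r \<equiv> h (Idl {\<gamma>} +> r)"

sublocale F: field F by (rule field_F)

sublocale I: ideal "Idl {\<gamma>}" R by (rule genideal_ideal) simp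

sublocale residue: ring_hom_ring R F residue
proof -
  have "h \<circ> (+>) (Idl {\<gamma>}) \<in> ring_hom R F"
    using I.rcos_ring_hom h_iso by (auto simp: ring_iso_def intro: ring_hom_trans)
  then show "ring_hom_ring R F residue"
    by (intro ring_hom_ringI2) (auto simp: comp_def ring_axioms F.ring_axioms)
qed

lemma bij_h: "bij_betw h (carrier (R Quot (Idl {\<gamma>}))) (carrier F)"
  using h_iso by (simp add: ring_iso_def)

lemma carrier_quot: "carrier (R Quot (Idl {\<gamma>})) = (\<lambda>r. Idl {\<gamma>} +> r) ` carrier R"
  by (auto simp: FactRing_simps)

lemma residue_surj: "residue ` carrier R = carrier F"
  using bij_h by (simp add: carrier_quot bij_betw_def image_image)

lemma finite_F: "finite (carrier F)"
  using finite_carrier by (simp flip: residue_surj)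

lemma card_quot: "card (carrier (R Quot (Idl {\<gamma>}))) = card (carrier F)"
  using bij_h by (rule bij_betw_same_card)

lemma card_F_ge_2: "2 \<le> card (carrier F)"
proof -
  have "card {\<zero>\<^bsub>F\<^esub>, \<one>\<^bsub>F\<^esub>} \<le> card (carrier F)" by (rule card_mono) (auto simp: finite_F)
  then show ?thesis using F.one_not_zero by simp
qed

text \<open>\<open>h\<close> is injective on cosets, so \<open>residue\<close> has the same kernel
  as the quotient map.\<close>

lemma residue_eq_zero_iff:
  assumes "r \<in> carrier R"
  shows "residue r = \<zero>\<^bsub>F\<^esub> \<longleftrightarrow> r \<in> Idl {\<gamma>}"
proof -
  have "residue \<zero> = \<zero>\<^bsub>F\<^esub>" by simp
  then have "residue r = \<zero>\<^bsub>F\<^esub> \<longleftrightarrow> residue r = residue \<zero>" by simp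
  also have "\<dots> \<longleftrightarrow> Idl {\<gamma>} +> r = Idl {\<gamma>} +> \<zero>"
    using bij_h assms by (intro inj_on_eq_iff[where A = "carrier (R Quot (Idl {\<gamma>}))"])
      (auto simp: bij_betw_def carrier_quot)
  also have "\<dots> \<longleftrightarrow> r \<in> Idl {\<gamma>}"
    using I.a_rcos_const I.a_rcos_self[OF assms] a_coset_add_zero[OF I.a_subset] by metis
  finally show ?thesis .
qed

lemma mem_ideal_left: "r \<in> Idl {\<gamma>} \<longleftrightarrow> (\<exists>x\<in>carrier R. r = \<gamma> \<otimes> x)"
  unfolding ideal_left l_coset_def by blast

lemma mem_ideal_right: "r \<in> Idl {\<gamma>} \<longleftrightarrow> (\<exists>x\<in>carrier R. r = x \<otimes> \<gamma>)"
  unfolding ideal_right r_coset_def by blast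

lemma one_notin_ideal: "\<one> \<notin> Idl {\<gamma>}"
  using residue_eq_zero_iff[of \<one>] F.one_not_zero by simp

section \<open>Left ideals and units\<close>

lemma left_ideal_Idl: "left_ideal (Idl {\<gamma>}) R"
  by (simp add: left_ideal_def I.additive_subgroup_axioms I.I_l_closed)

lemma left_ideal_multiples:
  assumes u: "u \<in> carrier R"
  shows "left_ideal ((\<lambda>x. x \<otimes> u) ` carrier R) R"
  unfolding left_ideal_def
proof (intro conjI ballI)
  show "additive_subgroup ((\<lambda>x. x \<otimes> u) ` carrier R) R"
  proof (intro additive_subgroupI add.subgroupI)
    fix a b assume "a \<in> (\<lambda>x. x \<otimes> u) ` carrier R" "b \<in> (\<lambda>x. x \<otimes> u) ` carrier R"
    then obtain x y where "x \<in> carrier R" "y \<in> carrier R" "a = x \<otimes> u" "b = y \<otimes> u" by auto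
    then show "a \<oplus> b \<in> (\<lambda>x. x \<otimes> u) ` carrier R"
      using u by (auto simp flip: l_distr)
  next
    fix a assume "a \<in> (\<lambda>x. x \<otimes> u) ` carrier R"
    then obtain x where "x \<in> carrier R" "a = x \<otimes> u" by auto
    then show "\<ominus> a \<in> (\<lambda>x. x \<otimes> u) ` carrier R"
      using u by (auto simp flip: l_minus)
  qed (use u in auto)
next
  fix r y assume r: "r \<in> carrier R" and "y \<in> (\<lambda>x. x \<otimes> u) ` carrier R"
  then obtain x where "x \<in> carrier R" "y = x \<otimes> u" by auto
  then show "r \<otimes> y \<in> (\<lambda>x. x \<otimes> u) ` carrier R"
    using u r by (auto simp flip: m_assoc)
qed

text \<open>Left multiplication by \<open>u\<close> is injective because \<open>v\<close> undoes it,
  hence surjective as the ring is finite. This yields a right inverse, which must equal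
  \<open>v\<close>.\<close>

lemma left_inverse_imp_unit:
  assumes [simp]: "u \<in> carrier R" "v \<in> carrier R" and vu: "v \<otimes> u = \<one>"
  shows "u \<in> Units R"
proof -
  have "inj_on (\<lambda>y. u \<otimes> y) (carrier R)"
    by (rule inj_on_inverseI[of _ "\<lambda>y. v \<otimes> y"]) (simp add: vu flip: m_assoc)
  then have "(\<lambda>y. u \<otimes> y) ` carrier R = carrier R"
    by (intro endo_inj_surj finite_carrier) auto
  then obtain w where w: "w \<in> carrier R" "u \<otimes> w = \<one>" by (metis image_iff one_closed)
  have "v = v \<otimes> (u \<otimes> w)" using w by simp
  also have "\<dots> = w" using w(1) vu by (simp flip: m_assoc)
  finally show ?thesis using w vu by (auto simp: Units_def)
qed

text \<open>
  By the chain condition \<open>Ru\<close> contains \<open>\<langle>\<gamma>\<rangle>\<close>; since \<open>u\<close> is invertible modulo \<open>\<langle>\<gamma>\<rangle>\<close>,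
  also \<open>1 \<in> Ru\<close>.
\<close>

lemma unit_if_notin_ideal:
  assumes u: "u \<in> carrier R" "u \<notin> Idl {\<gamma>}"
  shows "u \<in> Units R"
proof -
  let ?J = "(\<lambda>x. x \<otimes> u) ` carrier R"
  have J: "left_ideal ?J R" using u(1) by (rule left_ideal_multiples)
  have "u \<in> ?J" using u(1) by (auto intro: image_eqI[of _ _ \<one>])
  then have IJ: "Idl {\<gamma>} \<subseteq> ?J" using left_ideal_chain[OF left_ideal_Idl J] u(2) by auto
  have "residue u \<in> Units F" using u by (simp add: F.field_Units residue_eq_zero_iff)
  then obtain c where "c \<in> carrier F" "c \<otimes>\<^bsub>F\<^esub> residue u = \<one>\<^bsub>F\<^esub>" by (auto simp: Units_def)
  then obtain v where v: "v \<in> carrier R" "residue v \<otimes>\<^bsub>F\<^esub> residue u = \<one>\<^bsub>F\<^esub>"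
    by (auto simp flip: residue_surj)
  have "residue (\<one> \<ominus> v \<otimes> u) = \<zero>\<^bsub>F\<^esub>"
    using u(1) v by (simp add: minus_eq F.r_neg)
  then have "\<one> \<ominus> v \<otimes> u \<in> ?J" using u(1) v IJ by (auto simp: residue_eq_zero_iff)
  moreover have "v \<otimes> u \<in> ?J" using v by auto
  ultimately have "(\<one> \<ominus> v \<otimes> u) \<oplus> v \<otimes> u \<in> ?J"
    using J additive_subgroup.a_closed by (fastforce simp: left_ideal_def)
  moreover have "(\<one> \<ominus> v \<otimes> u) \<oplus> v \<otimes> u = \<one>"
    using u(1) v(1) by (simp add: minus_eq a_assoc l_neg)
  ultimately obtain w where "w \<in> carrier R" "w \<otimes> u = \<one>" by auto
  then show ?thesis using left_inverse_imp_unit u(1) by blast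
qed

section \<open>Powers of \<open>\<gamma>\<close> and the annihilator of
  \<open>\<gamma>\<close>\<close>

lemma pow_s: "\<gamma> [^] s = \<zero>" "0 < s"
  using nilp by (auto simp: nilpotency_index_def)

lemma one_ne_zero: "\<one> \<noteq> \<zero>"
  using one_notin_ideal I.zero_closed by metis

text \<open>\<open>nilpotency_index\<close> speaks of positive exponents; for \<open>t = 0\<close>
  the claim is that the ring is nontrivial.\<close>

lemma pow_ne_zero: "t < s \<Longrightarrow> \<gamma> [^] t \<noteq> \<zero>"
  using nilp one_ne_zero by (cases "t = 0") (auto simp: nilpotency_index_def)

text \<open>Since \<open>\<gamma>R = R\<gamma>\<close>, a scalar can be moved past one factor
  \<open>\<gamma>\<close> at a time. It may change at each move, so the induction is over all
  \<open>x\<close>.\<close>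

lemma pow_commute:
  assumes "x \<in> carrier R"
  shows "\<exists>y\<in>carrier R. \<gamma> [^] (i::nat) \<otimes> x = y \<otimes> \<gamma> [^] i"
  using assms
proof (induction i arbitrary: x)
  case (Suc i)
  obtain y where y: "y \<in> carrier R" "\<gamma> \<otimes> x = y \<otimes> \<gamma>"
    using Suc.prems mem_ideal_left mem_ideal_right by blast
  obtain z where z: "z \<in> carrier R" "\<gamma> [^] i \<otimes> y = z \<otimes> \<gamma> [^] i"
    using Suc.IH y(1) by blast
  have "\<gamma> [^] Suc i \<otimes> x = \<gamma> [^] i \<otimes> (\<gamma> \<otimes> x)"
    using Suc.prems by (simp add: m_assoc)
  also have "\<dots> = \<gamma> [^] i \<otimes> y \<otimes> \<gamma>" using y by (simp add: m_assoc)
  also have "\<dots> = z \<otimes> \<gamma> [^] Suc i" using z by (simp add: m_assoc)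
  finally show ?case using z(1) by blast
qed auto

lemma Suc_pow: "\<gamma> \<otimes> \<gamma> [^] (s - 1) = \<zero>"
proof -
  have "\<gamma> \<otimes> \<gamma> [^] (s - 1) = \<gamma> [^] Suc (s - 1)" by (simp only: nat_pow_Suc2 gamma_closed)
  then show ?thesis using pow_s by simp
qed

text \<open>Outside the ideal \<open>r\<close> is a unit and could be cancelled, leaving a vanishing
  power below \<open>s\<close>. This makes
  \<open>r \<mapsto> r \<otimes> \<gamma> [^] (s - 1)\<close> well defined and injective on residue
  classes.\<close>

lemma mult_pow_eq_zero_iff:
  assumes r: "r \<in> carrier R"
  shows "r \<otimes> \<gamma> [^] (s - 1) = \<zero> \<longleftrightarrow> r \<in> Idl {\<gamma>}"
proof
  assume eq: "r \<otimes> \<gamma> [^] (s - 1) = \<zero>"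
  show "r \<in> Idl {\<gamma>}"
  proof (rule ccontr)
    assume "r \<notin> Idl {\<gamma>}"
    then have u: "r \<in> Units R" using unit_if_notin_ideal r by blast
    have "inv r \<otimes> (r \<otimes> \<gamma> [^] (s - 1)) = \<zero>" using eq u by simp
    then have "\<gamma> [^] (s - 1) = \<zero>" using u r by (simp flip: m_assoc)
    then show False using pow_ne_zero[of "s - 1"] pow_s(2) by simp
  qed
next
  assume "r \<in> Idl {\<gamma>}"
  then show "r \<otimes> \<gamma> [^] (s - 1) = \<zero>"
    using Suc_pow by (auto simp: mem_ideal_right m_assoc)
qed

text \<open>Factors \<open>\<gamma>\<close> are split off from \<open>x\<close> on the left one by
  one. If \<open>x = \<gamma> [^] i \<otimes> y\<close> with \<open>y\<close> a unit, then
  \<open>\<gamma> \<otimes> x = \<zero>\<close> would give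
  \<open>\<gamma> [^] Suc i = \<zero>\<close>, too early while \<open>Suc i < s\<close>; so
  \<open>y\<close> is again divisible by \<open>\<gamma>\<close>. At the end
  \<open>pow_commute\<close> moves the power to the right.\<close>

lemma annihilator_of_gamma:
  assumes x: "x \<in> carrier R" "\<gamma> \<otimes> x = \<zero>"
  shows "\<exists>r\<in>carrier R. x = r \<otimes> \<gamma> [^] (s - 1)"
proof -
  have "\<exists>y\<in>carrier R. x = \<gamma> [^] i \<otimes> y" if "i < s" for i
    using that
  proof (induction i)
    case 0 then show ?case using x by auto
  next
    case (Suc i)
    then obtain y where y: "y \<in> carrier R" "x = \<gamma> [^] i \<otimes> y" by auto
    have "y \<in> Idl {\<gamma>}"
    proof (rule ccontr)
      assume "y \<notin> Idl {\<gamma>}"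
      then have u: "y \<in> Units R" using unit_if_notin_ideal y(1) by blast
      have "\<gamma> [^] Suc i \<otimes> y = \<gamma> \<otimes> x"
        using y by (simp only: nat_pow_Suc2 gamma_closed) (simp add: m_assoc)
      then have "\<gamma> [^] Suc i \<otimes> y \<otimes> inv y = \<zero>" using x u by simp
      then have "\<gamma> [^] Suc i = \<zero>" using u y(1) by (simp add: m_assoc del: nat_pow_Suc)
      then show False using pow_ne_zero Suc.prems by blast
    qed
    then obtain z where "z \<in> carrier R" "y = \<gamma> \<otimes> z" by (auto simp: mem_ideal_left)
    then show ?case using y by (auto simp: m_assoc)
  qed
  from this[of "s - 1"] obtain y where "y \<in> carrier R" "x = \<gamma> [^] (s - 1) \<otimes> y"
    using pow_s(2) by auto
  then show ?thesis using pow_commute by metis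
qed

lemma mult_pow_in_socle: "r \<in> carrier R \<Longrightarrow> r \<otimes> \<gamma> [^] (s - 1) \<in> ring_socle R \<gamma> s"
  unfolding ring_socle_def
  by (intro ideal.I_l_closed genideal_ideal genideal_self') auto

section \<open>Rank of a code and size of its socle\<close>

text \<open>A section of \<open>residue\<close>; its values on \<open>F\<close> are the transversal
  of the cosets of the maximal ideal.\<close>

definition lift :: "'c \<Rightarrow> 'a" where "lift = inv_into (carrier R) residue"

lemma lift_closed: "c \<in> carrier F \<Longrightarrow> lift c \<in> carrier R"
  by (simp add: lift_def inv_into_into residue_surj)

lemma residue_lift: "c \<in> carrier F \<Longrightarrow> residue (lift c) = c"
  unfolding lift_def by (rule f_inv_into_f) (simp add: residue_surj)

text \<open>The kernel of multiplication by \<open>\<gamma>\<close> on \<open>C\<close>. By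
  \<open>annihilator_of_gamma\<close>, applied to each coordinate, its words lie in the socle of the
  code.\<close>

abbreviation gamma_torsion :: "nat \<Rightarrow> (nat \<Rightarrow> 'a) set \<Rightarrow> (nat \<Rightarrow> 'a) set" where
  "gamma_torsion n C \<equiv> {c \<in> C. \<gamma> \<odot>\<^bsub>vec_module R n\<^esub> c = \<zero>\<^bsub>vec_module R n\<^esub>}"

lemma code_finite:
  assumes C: "linear_code R n C"
  shows "finite C"
  using C left_module.submodule_iff[OF left_module_vec_module] finite_vec_module[OF finite_carrier]
  unfolding linear_code_def by (metis finite_subset)

text \<open>Each fibre of multiplication by \<open>\<gamma>\<close> is a translate of the kernel, so
  a word is determined by its image and its offset from a chosen point of the fibre.\<close>

lemma card_code_le:
  assumes C: "linear_code R n C"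
  shows "card C \<le> card ((\<lambda>c. \<gamma> \<odot>\<^bsub>vec_module R n\<^esub> c) ` C) * card (gamma_torsion n C)"
proof -
  let ?V = "vec_module R n"
  interpret V: left_module R ?V by (rule left_module_vec_module)
  let ?f = "\<lambda>c. \<gamma> \<odot>\<^bsub>?V\<^esub> c"
  \<comment> \<open>The chosen point depends on \<open>?f c\<close> alone, so words with equal
    images share it.\<close>
  let ?\<rho> = "\<lambda>c. inv_into C ?f (?f c)"
  have sub: "submodule C R ?V" using C by (simp add: linear_code_def)
  then have CV: "c \<in> carrier ?V" if "c \<in> C" for c using that by (auto simp: V.submodule_iff)
  have \<rho>: "?\<rho> c \<in> C" "?f (?\<rho> c) = ?f c" if "c \<in> C" for c
    using inv_into_into[of "?f c" ?f C] f_inv_into_f[of "?f c" ?f C] that by auto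
  have "inj_on (\<lambda>c. (?f c, c \<ominus>\<^bsub>?V\<^esub> ?\<rho> c)) C"
  proof (rule inj_onI)
    fix c d assume cd: "c \<in> C" "d \<in> C" and "(?f c, c \<ominus>\<^bsub>?V\<^esub> ?\<rho> c) = (?f d, d \<ominus>\<^bsub>?V\<^esub> ?\<rho> d)"
    then have "c \<ominus>\<^bsub>?V\<^esub> ?\<rho> c = d \<ominus>\<^bsub>?V\<^esub> ?\<rho> c" by (metis prod.inject)
    then show "c = d" using CV[OF cd(1)] CV[OF cd(2)] CV[OF \<rho>(1)[OF cd(1)]]
      by (simp add: V.M.minus_eq)
  qed
  then have "card C \<le> card (?f ` C \<times> gamma_torsion n C)"
  proof (rule card_inj_on_le)
    show "(\<lambda>c. (?f c, c \<ominus>\<^bsub>?V\<^esub> ?\<rho> c)) ` C \<subseteq> ?f ` C \<times> gamma_torsion n C"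
    proof (rule image_subsetI)
      fix c assume c: "c \<in> C"
      have "?f (c \<ominus>\<^bsub>?V\<^esub> ?\<rho> c) = \<zero>\<^bsub>?V\<^esub>"
        using V.smult_r_minus[OF gamma_closed CV[OF c] CV[OF \<rho>(1)[OF c]]] CV[OF c] \<rho>(2)[OF c]
        by (simp add: V.M.minus_eq V.M.r_neg)
      then show "(?f c, c \<ominus>\<^bsub>?V\<^esub> ?\<rho> c) \<in> ?f ` C \<times> gamma_torsion n C"
        using c V.submodule_minus[OF sub c \<rho>(1)[OF c]] by simp
    qed
  qed (use code_finite[OF C] in simp)
  then show ?thesis by (simp add: card_cartesian_product)
qed

text \<open>If two residue tuples give the same coset of \<open>\<gamma>C\<close>, the coincidence
  is a relation between minimal generators. Its coefficients are nonunits, hence have residue zero,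
  and the tuples agree.\<close>

lemma card_code_ge:
  assumes C: "linear_code R n C"
  shows "card (carrier F) ^ code_rank R n C * card ((\<lambda>c. \<gamma> \<odot>\<^bsub>vec_module R n\<^esub> c) ` C) \<le> card C"
proof -
  let ?V = "vec_module R n"
  interpret V: left_module R ?V by (rule left_module_vec_module)
  let ?f = "\<lambda>c. \<gamma> \<odot>\<^bsub>?V\<^esub> c"
  have sub: "submodule C R ?V" using C by (simp add: linear_code_def)
  obtain G where G: "finite G" "G \<subseteq> carrier ?V" "card G = code_rank R n C" "code_span R n G = C"
    and min: "\<And>a g. \<lbrakk>a \<in> G \<rightarrow> carrier R; (\<Oplus>\<^bsub>?V\<^esub>g\<in>G. a g \<odot>\<^bsub>?V\<^esub> g) = \<zero>\<^bsub>?V\<^esub>; g \<in> G\<rbrakk>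
       \<Longrightarrow> a g \<notin> Units R"
    by (rule ex_minimal_generators[OF finite_carrier C]) (rule that)
  let ?comb = "\<lambda>a. \<Oplus>\<^bsub>?V\<^esub>g\<in>G. a g \<odot>\<^bsub>?V\<^esub> g"
  have summand: "(\<lambda>g. a g \<odot>\<^bsub>?V\<^esub> g) \<in> G \<rightarrow> carrier ?V" if "a \<in> G \<rightarrow> carrier R" for a
    using that G(2) by (auto intro!: V.smult_closed)
  have GC: "g \<in> C" if "g \<in> G" for g
    using that G(4) by (auto simp: code_span_def)
  have combC: "?comb a \<in> C" if "a \<in> G \<rightarrow> carrier R" for a
    using that GC by (intro V.submodule_finsum[OF sub]) (auto intro!: submodule.smult_closed[OF sub])
  have CV: "c \<in> carrier ?V" if "c \<in> C" for c using that sub by (auto simp: V.submodule_iff)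
  have comb: "\<exists>a\<in>G \<rightarrow> carrier R. c = ?comb a" if "c \<in> C" for c
    using that code_span_eq[OF G(1,2)] G(4) by auto
  \<comment> \<open>A summand from \<open>\<gamma>C\<close> is absorbed into the coefficients,
    changing each by a left multiple of \<open>\<gamma>\<close>, which \<open>residue\<close> does
    not see.\<close>
  have sum_comb: "?comb a \<oplus>\<^bsub>?V\<^esub> ?f (?comb r) = ?comb (\<lambda>g. a g \<oplus> \<gamma> \<otimes> r g)"
    if a: "a \<in> G \<rightarrow> carrier R" and r: "r \<in> G \<rightarrow> carrier R" for a r
  proof -
    have gr: "(\<lambda>g. \<gamma> \<otimes> r g) \<in> G \<rightarrow> carrier R" using r by auto
    have "?f (?comb r) = (\<Oplus>\<^bsub>?V\<^esub>g\<in>G. \<gamma> \<odot>\<^bsub>?V\<^esub> (r g \<odot>\<^bsub>?V\<^esub> g))"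
      using summand[OF r] by (intro V.smult_finsum) auto
    also have "\<dots> = ?comb (\<lambda>g. \<gamma> \<otimes> r g)"
    proof (rule V.M.finsum_cong')
      fix g assume "g \<in> G"
      then have "r g \<in> carrier R" "g \<in> carrier ?V" using r G(2) by auto
      then show "\<gamma> \<odot>\<^bsub>?V\<^esub> (r g \<odot>\<^bsub>?V\<^esub> g) = (\<gamma> \<otimes> r g) \<odot>\<^bsub>?V\<^esub> g"
        by (rule V.smult_assoc[OF gamma_closed, symmetric])
    qed (use summand[OF gr] in simp_all)
    finally have "?comb a \<oplus>\<^bsub>?V\<^esub> ?f (?comb r) =
        (\<Oplus>\<^bsub>?V\<^esub>g\<in>G. a g \<odot>\<^bsub>?V\<^esub> g \<oplus>\<^bsub>?V\<^esub> (\<gamma> \<otimes> r g) \<odot>\<^bsub>?V\<^esub> g)"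
      using V.M.finsum_addf[OF summand[OF a] summand[OF gr]] by simp
    also have "\<dots> = ?comb (\<lambda>g. a g \<oplus> \<gamma> \<otimes> r g)"
    proof (rule V.M.finsum_cong')
      show "(\<lambda>g. (a g \<oplus> \<gamma> \<otimes> r g) \<odot>\<^bsub>?V\<^esub> g) \<in> G \<rightarrow> carrier ?V"
        using a gr by (intro summand) auto
      fix g assume "g \<in> G"
      then have "a g \<in> carrier R" "\<gamma> \<otimes> r g \<in> carrier R" "g \<in> carrier ?V" using a gr G(2) by auto
      then show "a g \<odot>\<^bsub>?V\<^esub> g \<oplus>\<^bsub>?V\<^esub> (\<gamma> \<otimes> r g) \<odot>\<^bsub>?V\<^esub> g = (a g \<oplus> \<gamma> \<otimes> r g) \<odot>\<^bsub>?V\<^esub> g"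
        by (rule V.smult_l_distr[symmetric])
    qed simp
    finally show ?thesis .
  qed
  have lift: "(\<lambda>g. lift (t g)) \<in> G \<rightarrow> carrier R" if "t \<in> G \<rightarrow>\<^sub>E carrier F" for t
    using that by (auto intro!: lift_closed)
  let ?\<phi> = "\<lambda>(t, y). ?comb (\<lambda>g. lift (t g)) \<oplus>\<^bsub>?V\<^esub> y"
  have "inj_on ?\<phi> ((G \<rightarrow>\<^sub>E carrier F) \<times> ?f ` C)"
  proof (rule inj_onI)
    fix p p' assume "p \<in> (G \<rightarrow>\<^sub>E carrier F) \<times> ?f ` C" "p' \<in> (G \<rightarrow>\<^sub>E carrier F) \<times> ?f ` C"
      and eq: "?\<phi> p = ?\<phi> p'"
    then obtain t t' c c' where p: "p = (t, ?f c)" "p' = (t', ?f c')"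
      and t: "t \<in> G \<rightarrow>\<^sub>E carrier F" "t' \<in> G \<rightarrow>\<^sub>E carrier F" and c: "c \<in> C" "c' \<in> C"
      by auto
    obtain r r' where r: "r \<in> G \<rightarrow> carrier R" "r' \<in> G \<rightarrow> carrier R" and cr: "c = ?comb r" "c' = ?comb r'"
      using comb c by blast
    let ?a = "\<lambda>g. lift (t g) \<oplus> \<gamma> \<otimes> r g" and ?a' = "\<lambda>g. lift (t' g) \<oplus> \<gamma> \<otimes> r' g"
    have a: "?a \<in> G \<rightarrow> carrier R" "?a' \<in> G \<rightarrow> carrier R" using lift[OF t(1)] lift[OF t(2)] r by (simp_all add: Pi_iff)
    have "?comb ?a = ?comb ?a'"
      using eq sum_comb[OF lift[OF t(1)] r(1)] sum_comb[OF lift[OF t(2)] r(2)] by (simp add: p cr)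
    note rel = V.finsum_smult_eqD[OF G(2) a this]
    have "t g = t' g" if g: "g \<in> G" for g
    proof -
      have cl: "lift (t g) \<in> carrier R" "lift (t' g) \<in> carrier R" "r g \<in> carrier R" "r' g \<in> carrier R"
        "t g \<in> carrier F" "t' g \<in> carrier F"
        using g lift[OF t(1)] lift[OF t(2)] r t by (simp_all add: Pi_iff PiE_iff)
      have "(\<lambda>g. ?a g \<ominus> ?a' g) \<in> G \<rightarrow> carrier R" using a by (simp add: Pi_iff)
      from min[OF this rel g] have "?a g \<ominus> ?a' g \<notin> Units R" .
      moreover have d: "?a g \<ominus> ?a' g \<in> carrier R" using cl by simp
      ultimately have "residue (?a g \<ominus> ?a' g) = \<zero>\<^bsub>F\<^esub>"
        unfolding residue_eq_zero_iff[OF d] using unit_if_notin_ideal[OF d] by argo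
      moreover have "residue \<gamma> = \<zero>\<^bsub>F\<^esub>"
        by (simp add: residue_eq_zero_iff genideal_self')
      ultimately have "t g \<ominus>\<^bsub>F\<^esub> t' g = \<zero>\<^bsub>F\<^esub>"
        using cl by (simp add: a_minus_def residue_lift)
      then show "t g = t' g" using cl by simp
    qed
    then have tt: "t = t'" using t by (intro PiE_ext)
    \<comment> \<open>With \<open>t = t'\<close> the common combination cancels. Only the images
      under \<open>?f\<close> are recovered, and these are the second components of the
      pairs.\<close>
    have "?f c = ?f c'"
      using eq c CV combC[OF lift[OF t(2)]] by (simp add: p tt)
    then show "p = p'" using p tt by simp
  qed
  then have "card ((G \<rightarrow>\<^sub>E carrier F) \<times> ?f ` C) \<le> card C"
  proof (rule card_inj_on_le)
    show "?\<phi> ` ((G \<rightarrow>\<^sub>E carrier F) \<times> ?f ` C) \<subseteq> C"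
      using combC[OF lift] sub by (auto simp: V.submodule_iff)
  qed (rule code_finite[OF C])
  then show ?thesis using G(1,3) by (simp add: card_cartesian_product card_PiE)
qed

text \<open>The two estimates of \<open>card C\<close> share the positive factor
  \<open>card ?D\<close>, which cancels.\<close>

lemma card_torsion_ge:
  assumes C: "linear_code R n C"
  shows "card (carrier F) ^ code_rank R n C \<le> card (gamma_torsion n C)"
proof -
  let ?D = "(\<lambda>c. \<gamma> \<odot>\<^bsub>vec_module R n\<^esub> c) ` C"
  interpret V: left_module R "vec_module R n" by (rule left_module_vec_module)
  have "C \<noteq> {}" using C by (auto simp: linear_code_def V.submodule_iff)
  then have "0 < card ?D" using code_finite[OF C] by (simp add: card_gt_0_iff)
  moreover have "card (carrier F) ^ code_rank R n C * card ?D \<le> card (gamma_torsion n C) * card ?D"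
    using card_code_ge[OF C] card_code_le[OF C] unfolding mult.commute[of "card (gamma_torsion n C)"]
    by (rule order_trans)
  ultimately show ?thesis by simp
qed

section \<open>The socle code\<close>

lemma mem_socle_codeE:
  assumes "v \<in> socle_code R \<gamma> s h n C"
  obtains r where "r \<in> {..<n} \<rightarrow>\<^sub>E carrier R" "v = (\<lambda>i\<in>{..<n}. residue (r i))"
    "(\<lambda>i\<in>{..<n}. r i \<otimes> \<gamma> [^] (s - 1)) \<in> C"
  using assms unfolding socle_code_def code_socle_def by auto

text \<open>Allows representatives \<open>r\<close> that are not extensional; that the word lies in
  the socle is automatic, its coordinates being multiples of
  \<open>\<gamma> [^] (s - 1)\<close>.\<close>

lemma mem_socle_codeI:
  assumes r: "\<And>i. i < n \<Longrightarrow> r i \<in> carrier R" and C: "(\<lambda>i\<in>{..<n}. r i \<otimes> \<gamma> [^] (s - 1)) \<in> C"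
  shows "(\<lambda>i\<in>{..<n}. residue (r i)) \<in> socle_code R \<gamma> s h n C"
proof -
  let ?r = "\<lambda>i\<in>{..<n}. r i"
  have eq: "(\<lambda>i\<in>{..<n}. residue (r i)) = (\<lambda>i\<in>{..<n}. residue (?r i))"
    "(\<lambda>i\<in>{..<n}. r i \<otimes> \<gamma> [^] (s - 1)) = (\<lambda>i\<in>{..<n}. ?r i \<otimes> \<gamma> [^] (s - 1))"
    by (auto simp: fun_eq_iff)
  have "?r \<in> {..<n} \<rightarrow>\<^sub>E carrier R" using r by auto
  moreover have "(\<lambda>i\<in>{..<n}. ?r i \<otimes> \<gamma> [^] (s - 1)) \<in> code_socle R \<gamma> s n C"
    using C r mult_pow_in_socle unfolding code_socle_def eq(2) by auto
  ultimately show ?thesis unfolding socle_code_def eq(1) by blast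
qed

lemma socle_code_subset: "socle_code R \<gamma> s h n C \<subseteq> {..<n} \<rightarrow>\<^sub>E carrier F"
proof
  fix v assume "v \<in> socle_code R \<gamma> s h n C"
  then obtain r where r: "r \<in> {..<n} \<rightarrow>\<^sub>E carrier R" "v = (\<lambda>i\<in>{..<n}. residue (r i))"
    by (rule mem_socle_codeE)
  have "residue (r i) \<in> carrier F" if "i < n" for i using r(1) that by (intro residue.hom_closed) auto
  then show "v \<in> {..<n} \<rightarrow>\<^sub>E carrier F" using r(2) by auto
qed

text \<open>The power of \<open>\<gamma>\<close> stands on the right of the representatives, so sums
  and left multiples of words in \<open>C\<close> are matched by sums and left multiples of
  representatives, and \<open>residue\<close> is a ring homomorphism.\<close>

lemma linear_socle_code:
  assumes C: "linear_code R n C"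
  shows "linear_code F n (socle_code R \<gamma> s h n C)"
proof -
  let ?V = "vec_module R n" and ?W = "vec_module F n" and ?D = "socle_code R \<gamma> s h n C"
  interpret V: left_module R ?V by (rule left_module_vec_module)
  interpret W: left_module F ?W by (rule F.left_module_vec_module)
  have zero: "\<zero>\<^bsub>?V\<^esub> \<in> C" and add: "\<And>x y. x \<in> C \<Longrightarrow> y \<in> C \<Longrightarrow> x \<oplus>\<^bsub>?V\<^esub> y \<in> C"
    and smult: "\<And>a x. a \<in> carrier R \<Longrightarrow> x \<in> C \<Longrightarrow> a \<odot>\<^bsub>?V\<^esub> x \<in> C"
    using C by (auto simp: linear_code_def V.submodule_iff)
  show ?thesis
    unfolding linear_code_def W.submodule_iff
  proof (intro conjI ballI)
    show "?D \<subseteq> carrier ?W" using socle_code_subset by (simp add: vec_module_def)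
  next
    have "(\<lambda>i\<in>{..<n}. \<zero> \<otimes> \<gamma> [^] (s - 1)) = \<zero>\<^bsub>?V\<^esub>" by (simp add: vec_module_def)
    then have "(\<lambda>i\<in>{..<n}. residue \<zero>) \<in> ?D" using zero by (intro mem_socle_codeI) auto
    then show "\<zero>\<^bsub>?W\<^esub> \<in> ?D" by (simp add: vec_module_def)
  next
    fix v w assume "v \<in> ?D" "w \<in> ?D"
    obtain r where r: "r \<in> {..<n} \<rightarrow>\<^sub>E carrier R" "v = (\<lambda>i\<in>{..<n}. residue (r i))"
      "(\<lambda>i\<in>{..<n}. r i \<otimes> \<gamma> [^] (s - 1)) \<in> C" using \<open>v \<in> ?D\<close> by (rule mem_socle_codeE)
    obtain t where t: "t \<in> {..<n} \<rightarrow>\<^sub>E carrier R" "w = (\<lambda>i\<in>{..<n}. residue (t i))"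
      "(\<lambda>i\<in>{..<n}. t i \<otimes> \<gamma> [^] (s - 1)) \<in> C" using \<open>w \<in> ?D\<close> by (rule mem_socle_codeE)
    have cl: "r i \<in> carrier R" "t i \<in> carrier R" if "i < n" for i using r(1) t(1) that by auto
    have "(\<lambda>i\<in>{..<n}. (r i \<oplus> t i) \<otimes> \<gamma> [^] (s - 1)) =
        (\<lambda>i\<in>{..<n}. r i \<otimes> \<gamma> [^] (s - 1)) \<oplus>\<^bsub>?V\<^esub> (\<lambda>i\<in>{..<n}. t i \<otimes> \<gamma> [^] (s - 1))"
      using cl by (auto simp: vec_module_def fun_eq_iff l_distr)
    then have "(\<lambda>i\<in>{..<n}. residue (r i \<oplus> t i)) \<in> ?D"
      using add[OF r(3) t(3)] cl by (intro mem_socle_codeI) auto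
    also have "(\<lambda>i\<in>{..<n}. residue (r i \<oplus> t i)) = v \<oplus>\<^bsub>?W\<^esub> w"
      using cl by (auto simp: vec_module_def fun_eq_iff r(2) t(2))
    finally show "v \<oplus>\<^bsub>?W\<^esub> w \<in> ?D" .
  next
    fix c v assume "c \<in> carrier F" "v \<in> ?D"
    obtain r where r: "r \<in> {..<n} \<rightarrow>\<^sub>E carrier R" "v = (\<lambda>i\<in>{..<n}. residue (r i))"
      "(\<lambda>i\<in>{..<n}. r i \<otimes> \<gamma> [^] (s - 1)) \<in> C" using \<open>v \<in> ?D\<close> by (rule mem_socle_codeE)
    obtain a where a: "a \<in> carrier R" "c = residue a"
      using \<open>c \<in> carrier F\<close> lift_closed residue_lift by metis
    have cl: "r i \<in> carrier R" if "i < n" for i using r(1) that by auto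
    have "(\<lambda>i\<in>{..<n}. (a \<otimes> r i) \<otimes> \<gamma> [^] (s - 1)) =
        a \<odot>\<^bsub>?V\<^esub> (\<lambda>i\<in>{..<n}. r i \<otimes> \<gamma> [^] (s - 1))"
      using cl a(1) by (auto simp: vec_module_def fun_eq_iff m_assoc)
    then have "(\<lambda>i\<in>{..<n}. residue (a \<otimes> r i)) \<in> ?D"
      using smult[OF a(1) r(3)] cl a(1) by (intro mem_socle_codeI) auto
    also have "(\<lambda>i\<in>{..<n}. residue (a \<otimes> r i)) = c \<odot>\<^bsub>?W\<^esub> v"
      using cl a by (auto simp: vec_module_def fun_eq_iff r(2))
    finally show "c \<odot>\<^bsub>?W\<^esub> v \<in> ?D" .
  qed
qed

text \<open>Dividing each coordinate by \<open>\<gamma> [^] (s - 1)\<close> and taking residues is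
  injective, because by \<open>mult_pow_eq_zero_iff\<close> the residue of the quotient determines
  the coordinate.\<close>

lemma card_torsion_le:
  assumes C: "linear_code R n C"
  shows "card (gamma_torsion n C) \<le> card (socle_code R \<gamma> s h n C)"
proof -
  let ?V = "vec_module R n"
  interpret V: left_module R ?V by (rule left_module_vec_module)
  have CV: "C \<subseteq> {..<n} \<rightarrow>\<^sub>E carrier R"
    using C V.submodule_iff[of C] by (simp add: linear_code_def) (simp add: vec_module_def)
  define \<rho> where "\<rho> x = (SOME r. r \<in> carrier R \<and> x = r \<otimes> \<gamma> [^] (s - 1))" for x
  have \<rho>: "\<rho> (c i) \<in> carrier R" "c i = \<rho> (c i) \<otimes> \<gamma> [^] (s - 1)"
    if c: "c \<in> gamma_torsion n C" and i: "i < n" for c i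
  proof -
    have "c i \<in> carrier R" using c i CV by auto
    moreover have "(\<gamma> \<odot>\<^bsub>?V\<^esub> c) i = \<zero>\<^bsub>?V\<^esub> i" using c by simp
    then have "\<gamma> \<otimes> c i = \<zero>" using i by (simp add: vec_module_def)
    ultimately have "\<exists>r. r \<in> carrier R \<and> c i = r \<otimes> \<gamma> [^] (s - 1)"
      using annihilator_of_gamma by blast
    then have "\<rho> (c i) \<in> carrier R \<and> c i = \<rho> (c i) \<otimes> \<gamma> [^] (s - 1)"
      unfolding \<rho>_def by (rule someI_ex)
    then show "\<rho> (c i) \<in> carrier R" "c i = \<rho> (c i) \<otimes> \<gamma> [^] (s - 1)" by blast+
  qed
  let ?\<phi> = "\<lambda>c. \<lambda>i\<in>{..<n}. residue (\<rho> (c i))"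
  have "inj_on ?\<phi> (gamma_torsion n C)"
  proof (rule inj_onI)
    fix c d assume c: "c \<in> gamma_torsion n C" and d: "d \<in> gamma_torsion n C"
      and eq: "?\<phi> c = ?\<phi> d"
    have "c i = d i" if i: "i < n" for i
    proof -
      let ?x = "\<rho> (c i)" and ?y = "\<rho> (d i)"
      have cl: "?x \<in> carrier R" "?y \<in> carrier R" using \<rho> c d i by auto
      have "residue ?x = residue ?y" using fun_cong[OF eq, of i] i by simp
      then have "residue (?x \<ominus> ?y) = \<zero>\<^bsub>F\<^esub>" using cl by (simp add: minus_eq F.r_neg)
      then have "?x \<ominus> ?y \<in> Idl {\<gamma>}" using cl residue_eq_zero_iff[of "?x \<ominus> ?y"] by simp
      then have "(?x \<ominus> ?y) \<otimes> \<gamma> [^] (s - 1) = \<zero>"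
        using cl mult_pow_eq_zero_iff[of "?x \<ominus> ?y"] by simp
      then have "?x \<otimes> \<gamma> [^] (s - 1) \<ominus> ?y \<otimes> \<gamma> [^] (s - 1) = \<zero>"
        using cl by (simp add: minus_eq l_distr l_minus)
      then have "?x \<otimes> \<gamma> [^] (s - 1) = ?y \<otimes> \<gamma> [^] (s - 1)" using cl by simp
      then show "c i = d i" using \<rho>(2)[OF c i] \<rho>(2)[OF d i] by metis
    qed
    then show "c = d" using c d CV by (intro PiE_ext[of c "{..<n}"]) auto
  qed
  then show ?thesis
  proof (rule card_inj_on_le)
    show "?\<phi> ` gamma_torsion n C \<subseteq> socle_code R \<gamma> s h n C"
    proof (rule image_subsetI)
      fix c assume c: "c \<in> gamma_torsion n C"
      have "(\<lambda>i\<in>{..<n}. \<rho> (c i) \<otimes> \<gamma> [^] (s - 1)) = c"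
      proof
        fix i show "(\<lambda>i\<in>{..<n}. \<rho> (c i) \<otimes> \<gamma> [^] (s - 1)) i = c i"
          \<comment> \<open>For \<open>i \<ge> n\<close> both sides are
            \<open>undefined\<close>.\<close>
          using \<rho>(2)[OF c, of i] PiE_arb[of c "{..<n}" _ i] c CV by (cases "i < n") auto
      qed
      then show "?\<phi> c \<in> socle_code R \<gamma> s h n C"
        using \<rho>(1)[OF c] c by (intro mem_socle_codeI) auto
    qed
    show "finite (socle_code R \<gamma> s h n C)"
      using socle_code_subset by (rule finite_subset) (simp add: finite_PiE finite_F)
  qed
qed

section \<open>Homogeneous weight against Hamming weight\<close>

lemma hom_const_pos: "0 < hom_const R \<gamma>"
  using card_F_ge_2 by (simp add: hom_const_def card_quot Let_def)

text \<open>The coordinates of \<open>c\<close> lie in the socle of the ring and vanish exactly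
  where \<open>v\<close> does, so each nonzero one contributes
  \<open>hom_const R \<gamma>\<close>.\<close>

lemma socle_word_weight:
  assumes v: "v \<in> socle_code R \<gamma> s h n C" "v \<noteq> \<zero>\<^bsub>vec_module F n\<^esub>"
  obtains c where "c \<in> C" "c \<noteq> \<zero>\<^bsub>vec_module R n\<^esub>"
    "hom_weight_vec R \<gamma> s n c = hom_const R \<gamma> * real (hamming_weight F n v)"
proof -
  obtain r where r: "r \<in> {..<n} \<rightarrow>\<^sub>E carrier R" "v = (\<lambda>i\<in>{..<n}. residue (r i))"
    "(\<lambda>i\<in>{..<n}. r i \<otimes> \<gamma> [^] (s - 1)) \<in> C" using v(1) by (rule mem_socle_codeE)
  define c where "c = (\<lambda>i\<in>{..<n}. r i \<otimes> \<gamma> [^] (s - 1))"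
  have cl: "r i \<in> carrier R" if "i < n" for i using r(1) that by auto
  have zero_iff: "c i = \<zero> \<longleftrightarrow> v i = \<zero>\<^bsub>F\<^esub>" if "i < n" for i
    using that cl[OF that] mult_pow_eq_zero_iff[of "r i"] residue_eq_zero_iff[of "r i"]
    by (simp add: c_def r(2))
  have "hom_weight R \<gamma> s (c i) = (if v i = \<zero>\<^bsub>F\<^esub> then 0 else hom_const R \<gamma>)" if "i < n" for i
    using zero_iff[OF that] mult_pow_in_socle[OF cl[OF that]] that
    by (simp add: hom_weight_def c_def)
  then have "hom_weight_vec R \<gamma> s n c = (\<Sum>i<n. if v i = \<zero>\<^bsub>F\<^esub> then 0 else hom_const R \<gamma>)"
    unfolding hom_weight_vec_def by (intro sum.cong) auto
  also have "\<dots> = (\<Sum>i\<in>{i. i < n \<and> v i \<noteq> \<zero>\<^bsub>F\<^esub>}. hom_const R \<gamma>)"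
    by (intro sum.mono_neutral_cong_right) auto
  finally have wt: "hom_weight_vec R \<gamma> s n c = hom_const R \<gamma> * real (hamming_weight F n v)"
    by (simp add: hamming_weight_def)
  have "c \<noteq> \<zero>\<^bsub>vec_module R n\<^esub>"
  proof
    assume c0: "c = \<zero>\<^bsub>vec_module R n\<^esub>"
    have "v i = \<zero>\<^bsub>vec_module F n\<^esub> i" for i
      using zero_iff[of i] c0 r(2) by (cases "i < n") (simp_all add: vec_module_def)
    then show False using v(2) by auto
  qed
  then show thesis using that wt r(3) by (simp add: c_def)
qed

lemma MHD_imp_MDS_socle_code:
  assumes "MHD_code R \<gamma> s n C"
  shows "MDS_code F n (socle_code R \<gamma> s h n C)"
proof -
  let ?D = "socle_code R \<gamma> s h n C" and ?q = "card (carrier F)" and ?M = "hom_const R \<gamma>"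
  let ?K = "code_rank R n C" and ?V = "vec_module R n" and ?W = "vec_module F n"
  interpret W: left_module F ?W by (rule F.left_module_vec_module)
  have C: "linear_code R n C" and MHD: "?M * (real n - real ?K) < hom_dist R \<gamma> s n C"
    using assms by (auto simp: MHD_code_def)
  have D: "linear_code F n ?D" using C by (rule linear_socle_code)
  obtain k where k: "code_dimension F n ?D k" "card ?D = ?q ^ k"
    using F.code_dimension_card[OF finite_F D] .
  have q: "1 < ?q" using card_F_ge_2 by simp
  have "?q ^ ?K \<le> ?q ^ k" using card_torsion_ge[OF C] card_torsion_le[OF C] k(2) by simp
  then have Kk: "?K \<le> k" using q by simp
  have "int (hamming_dist F n ?D) = int n - int k + 1"
  proof (cases "?D = {\<zero>\<^bsub>?W\<^esub>}")
    case True
    \<comment> \<open>The conventional distance \<open>n + 1\<close> of the zero code is the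
      required value for \<open>k = 0\<close>.\<close>
    then have "?q ^ k = 1" using k(2) by simp
    then have "k = 0" using q by simp
    then show ?thesis using True by (simp add: hamming_dist_def)
  next
    case False
    let ?D' = "?D - {\<zero>\<^bsub>?W\<^esub>}"
    let ?d = "Min (hamming_weight F n ` ?D')"
    have "finite ?D"
      using socle_code_subset by (rule finite_subset) (simp add: finite_PiE finite_F)
    then have fin: "finite (hamming_weight F n ` ?D')" by simp
    have "\<zero>\<^bsub>?W\<^esub> \<in> ?D" using D by (simp add: linear_code_def W.submodule_iff)
    then have "hamming_weight F n ` ?D' \<noteq> {}" using False by auto
    from Min_in[OF fin this] obtain v where v: "v \<in> ?D" "v \<noteq> \<zero>\<^bsub>?W\<^esub>" "?d = hamming_weight F n v"
      by auto
    obtain c where c: "c \<in> C" "c \<noteq> \<zero>\<^bsub>?V\<^esub>"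
      "hom_weight_vec R \<gamma> s n c = ?M * real ?d"
      using socle_word_weight[OF v(1,2)] v(3) by metis
    have "hom_dist R \<gamma> s n C = Min (hom_weight_vec R \<gamma> s n ` (C - {\<zero>\<^bsub>?V\<^esub>}))"
      using c(1,2) by (auto simp: hom_dist_def)
    also have "\<dots> \<le> ?M * real ?d"
      using c(1,2) code_finite[OF C] unfolding c(3)[symmetric] by (intro Min_le) auto
    \<comment> \<open>The positive factor \<open>?M\<close> cancels; strictness then gives
      \<open>n + 1 \<le> ?d + ?K\<close> in integers.\<close>
    finally have "real n - real ?K < real ?d"
      using MHD hom_const_pos by (meson le_less_trans less_le_trans mult_less_cancel_left_pos)
    then have dK: "n < ?d + ?K" by linarith
    have "{i. i < n \<and> v i \<noteq> \<zero>\<^bsub>F\<^esub>} \<subseteq> {..<n}" by auto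
    then have dn: "?d \<le> n" using card_mono[of "{..<n}"] v(3) by (fastforce simp: hamming_weight_def)
    have "\<exists>i<n. v i \<noteq> \<zero>\<^bsub>F\<^esub>"
    proof (rule ccontr)
      assume "\<not> (\<exists>i<n. v i \<noteq> \<zero>\<^bsub>F\<^esub>)"
      moreover have "v i = undefined" if "\<not> i < n" for i
        using PiE_arb[of v "{..<n}" _ i] v(1) socle_code_subset that by blast
      ultimately have "v = \<zero>\<^bsub>?W\<^esub>" by (auto simp: vec_module_def fun_eq_iff)
      then show False using v(2) by contradiction
    qed
    then have "{i. i < n \<and> v i \<noteq> \<zero>\<^bsub>F\<^esub>} \<noteq> {}" by auto
    then have "0 < ?d" unfolding v(3) hamming_weight_def by (simp add: card_gt_0_iff)
    then have "?q ^ k \<le> ?q ^ (n + 1 - ?d)"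
      unfolding k(2)[symmetric] by (intro F.singleton_bound_card finite_F D Min_le fin) auto
    then have "k \<le> n + 1 - ?d" using q by simp
    \<comment> \<open>\<open>?d \<le> n\<close> makes the truncated subtraction exact, so the
      Singleton bound reads \<open>?d + k \<le> n + 1\<close>; with \<open>?K \<le> k\<close> the
      MHD bound gives the reverse inequality.\<close>
    then have "int ?d = int n - int k + 1" using dK dn Kk by linarith
    then show ?thesis using False by (simp add: hamming_dist_def)
  qed
  then show ?thesis using D k(1) by (auto simp: MDS_code_def)
qed

end

theorem theorem15:
  fixes R :: "('a, 'b) ring_scheme"
    and F :: "('c, 'd) ring_scheme"
    and \<gamma> :: 'a
    and s n :: nat
    and h :: "'a set \<Rightarrow> 'c"
    and C :: "(nat \<Rightarrow> 'a) set"
  assumes "finite_chain_ring R"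
    and "\<gamma> \<in> carrier R"
    and "maximalideal (Idl\<^bsub>R\<^esub> {\<gamma>}) R"
    and "Idl\<^bsub>R\<^esub> {\<gamma>} = \<gamma> <#\<^bsub>R\<^esub> carrier R"
    and "Idl\<^bsub>R\<^esub> {\<gamma>} = carrier R #>\<^bsub>R\<^esub> \<gamma>"
    and "nilpotency_index R \<gamma> s"
    and "field F"
    and "h \<in> ring_iso (R Quot (Idl\<^bsub>R\<^esub> {\<gamma>})) F"
    and "n \<ge> 1"
    and "MHD_code R \<gamma> s n C"
  shows "MDS_code F n (socle_code R \<gamma> s h n C)"
  using assms
  by (intro chain_ring_residue_field.MHD_imp_MDS_socle_code chain_ring_residue_field.intro
      chain_ring_residue_field_axioms.intro)

end
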